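(* Let $d\ge 1$, $\varepsilon>0$, $\Delta t>0$, $\Omega=[-1,1]^d$. If $\Delta t\le 2\varepsilon^2$, then the Crank-Nicolson scheme for the Allen-Cahn equation is stable: for every given smooth $\phi^n:\Omega\to\mathbb{R}$ with $\frac{\partial \phi^n}{\partial \mathbf{n}}=0$ on $\partial\Omega$, there is at most one smooth function $\phi^{n+1}:\Omega\to\mathbb{R}$ satisfying $$\frac{\phi^{n+1}-\phi^n}{\Delta t}-\frac12\big(\Delta\phi^{n+1}+\Delta\phi^n\big)+\frac{1}{2\varepsilon^2}\big((\phi^{n+1})^3-\phi^{n+1}\big)+\frac{1}{2\varepsilon^2}\big((\phi^{n})^3-\phi^{n}\big)=0\ \text{ in }\Omega,\qquad \frac{\partial \phi^{n+1}}{\partial \mathbf{n}}=0\ \text{ on }\partial\Omega .$$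
   Context: The Allen-Cahn equation is $\phi_t-\Delta\phi+\frac{1}{\varepsilon^2}(\phi^3-\phi)=0$ on $\Omega=[-1,1]^d$ with homogeneous Neumann boundary conditions. $\Delta$ applied to a function is the Laplacian in $x=(x_1,\dots,x_d)$; $\Delta t$ is a single symbol, the time step size. $\mathbf{n}$ is the unit outward normal; on the cube the condition $\frac{\partial\phi}{\partial\mathbf{n}}=0$ means $\partial_{x_i}\phi=0$ on each face $x_i=\pm1$. "Smooth" means $C^\infty$ up to the boundary. A scheme relating $\phi^n$ and $\phi^{n+1}$ is called stable if $\phi^{n+1}$ is unique given $\phi^n$. *)

theory Defs
  imports "HOL-Analysis.Analysis"
begin

definition Omega :: "(real ^ 'n) set" where
  "Omega = cbox (\<chi> i. - 1) (\<chi> i. 1)"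

text \<open>
  Derivatives are taken within the closed cube, so they are one-sided at boundary points.
  The cube is convex with nonempty interior, hence the Frechet derivative within it is unique
  wherever it exists (lemma \<open>partial_eqI\<close> below), and on the interior it is the ordinary derivative.
  Everything below depends only on the values of the functions on the cube.
\<close>

definition partial :: "'n \<Rightarrow> (real ^ 'n \<Rightarrow> real) \<Rightarrow> real ^ 'n \<Rightarrow> real" where
  "partial i u x = frechet_derivative u (at x within Omega) (axis i 1)"

primrec C_k_on_Omega :: "nat \<Rightarrow> (real ^ 'n \<Rightarrow> real) \<Rightarrow> bool" where
  "C_k_on_Omega 0 u \<longleftrightarrow> continuous_on Omega u"
| "C_k_on_Omega (Suc k) u \<longleftrightarrow> u differentiable_on Omega \<and> (\<forall>i. C_k_on_Omega k (partial i u))"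

definition smooth_on_Omega :: "(real ^ 'n \<Rightarrow> real) \<Rightarrow> bool" where
  "smooth_on_Omega u \<longleftrightarrow> (\<forall>k. C_k_on_Omega k u)"

definition laplacian :: "(real ^ 'n \<Rightarrow> real) \<Rightarrow> real ^ 'n \<Rightarrow> real" where
  "laplacian u x = (\<Sum>i\<in>UNIV. partial i (partial i u) x)"

definition neumann :: "(real ^ 'n \<Rightarrow> real) \<Rightarrow> bool" where
  "neumann u \<longleftrightarrow> (\<forall>x\<in>Omega. \<forall>i. x $ i = 1 \<or> x $ i = - 1 \<longrightarrow> partial i u x = 0)"

text \<open>
  \<open>crank_nicolson \<epsilon> \<tau> \<phi> \<psi>\<close>: with time step \<open>\<tau>\<close>, the function \<open>\<psi>\<close> satisfies the equation
  for the new time level, where \<open>\<phi>\<close> is the old one.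
\<close>

definition crank_nicolson ::
    "real \<Rightarrow> real \<Rightarrow> (real ^ 'n \<Rightarrow> real) \<Rightarrow> (real ^ 'n \<Rightarrow> real) \<Rightarrow> bool" where
  "crank_nicolson \<epsilon> \<tau> \<phi> \<psi> \<longleftrightarrow>
     (\<forall>x\<in>Omega.
        (\<psi> x - \<phi> x) / \<tau> - 1 / 2 * (laplacian \<psi> x + laplacian \<phi> x)
          + 1 / (2 * \<epsilon>\<^sup>2) * ((\<psi> x) ^ 3 - \<psi> x) + 1 / (2 * \<epsilon>\<^sup>2) * ((\<phi> x) ^ 3 - \<phi> x) = 0)"

text \<open>
  Functions on the cube are represented by total functions, so uniqueness means equality on the cube.
\<close>

definition stable_scheme :: "((real ^ 'n \<Rightarrow> real) \<Rightarrow> (real ^ 'n \<Rightarrow> real) \<Rightarrow> bool) \<Rightarrow> bool" where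
  "stable_scheme R \<longleftrightarrow>
     (\<forall>\<phi>. smooth_on_Omega \<phi> \<and> neumann \<phi> \<longrightarrow>
        (\<forall>\<psi>\<^sub>1 \<psi>\<^sub>2. smooth_on_Omega \<psi>\<^sub>1 \<and> neumann \<psi>\<^sub>1 \<and> R \<phi> \<psi>\<^sub>1 \<longrightarrow>
                 smooth_on_Omega \<psi>\<^sub>2 \<and> neumann \<psi>\<^sub>2 \<and> R \<phi> \<psi>\<^sub>2 \<longrightarrow>
                 (\<forall>x\<in>Omega. \<psi>\<^sub>1 x = \<psi>\<^sub>2 x)))"

lemma partial_eqI:
  fixes u :: "real ^ 'n \<Rightarrow> real"
  assumes "x \<in> Omega" and D: "(u has_derivative D) (at x within Omega)"
  shows "partial i u x = D (axis i 1)"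
proof -
  have "(u has_derivative frechet_derivative u (at x within Omega)) (at x within Omega)"
    using D differentiableI frechet_derivative_works by blast
  then have "frechet_derivative u (at x within Omega) = D"
    using assms unfolding Omega_def
    by (intro frechet_derivative_unique_within_closed_interval)
       (auto simp: Basis_vec_def inner_axis)
  then show ?thesis by (simp add: partial_def)
qed

end

theory Submission
  imports Defs
begin

text \<open>
  The scheme obeys a maximum principle. Let \<open>w\<close> be the difference of two solutions \<open>\<psi>\<^sub>1\<close>, \<open>\<psi>\<^sub>2\<close> for
  the same old level. Subtracting the two equations gives \<open>\<Delta>w = c w\<close> with
  \<open>c = 2 / \<tau> - 1 / \<epsilon>\<^sup>2 + (\<psi>\<^sub>1\<^sup>2 + \<psi>\<^sub>1 \<psi>\<^sub>2 + \<psi>\<^sub>2\<^sup>2) / \<epsilon>\<^sup>2\<close>. The step size restriction makes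
  \<open>2 / \<tau> - 1 / \<epsilon>\<^sup>2\<close> nonnegative, and the quadratic form is positive wherever \<open>\<psi>\<^sub>1 \<noteq> \<psi>\<^sub>2\<close>, so
  \<open>\<Delta>w > 0\<close> wherever \<open>w > 0\<close>.

  On the other hand \<open>\<Delta>w \<le> 0\<close> at a point where \<open>w\<close> attains its maximum over the closed cube, even if
  that point lies on the boundary: along each coordinate line the derivative of \<open>w\<close> vanishes there,
  by Fermat's criterion in the interior and by the Neumann condition on a face, so the (possibly
  one-sided) second derivative cannot be positive (\<open>second_derivative_nonpos_at_max\<close> and
  \<open>laplacian_le_at_max\<close>). Hence the maximum of \<open>w\<close> is not positive, and by symmetry \<open>w = 0\<close>.
\<close>

text \<open>
  The second derivative test on a compact interval. At an endpoint the vanishing of the first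
  derivative is a hypothesis; at an interior point it follows from maximality.
\<close>

lemma second_derivative_nonpos_at_max:
  fixes g g' :: "real \<Rightarrow> real"
  assumes "a < b" and s: "s \<in> {a..b}"
    and g: "\<And>t. t \<in> {a..b} \<Longrightarrow> (g has_real_derivative g' t) (at t within {a..b})"
    and g': "(g' has_real_derivative d) (at s within {a..b})"
    and max: "\<And>t. t \<in> {a..b} \<Longrightarrow> g t \<le> g s"
    and endpoint: "s = a \<or> s = b \<Longrightarrow> g' s = 0"
  shows "d \<le> 0"
proof (rule ccontr)
  assume "\<not> d \<le> 0"
  then have "0 < d" by simp
  have crit: "g' s = 0"
  proof (cases "s = a \<or> s = b")
    case False
    then have "s \<in> {a<..<b}" using s by auto
    then have "(g has_real_derivative g' s) (at s)"
      using g[OF s] by (metis at_within_Icc_at greaterThanLessThan_iff)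
    moreover have "0 < min (s - a) (b - s)" using \<open>s \<in> {a<..<b}\<close> by auto
    moreover have "\<forall>t. \<bar>s - t\<bar> < min (s - a) (b - s) \<longrightarrow> g t \<le> g s"
      using max by (auto simp: abs_if split: if_splits)
    ultimately show ?thesis by (rule DERIV_local_max)
  qed (rule endpoint)
  have mvt: "\<exists>z\<in>{u<..<v}. g v - g u = g' z * (v - u)" if "a \<le> u" "u < v" "v \<le> b" for u v
  proof (rule mvt_simple[OF \<open>u < v\<close>])
    fix x assume "u \<le> x" "x \<le> v"
    then show "(g has_derivative (*) (g' x)) (at x within {u..v})"
      using g[of x] that unfolding has_field_derivative_def
      by (auto intro: has_derivative_subset)
  qed
  show False
  proof (cases "s < b")
    case True
    obtain e where e: "e > 0" "\<And>h. \<lbrakk>h > 0; s + h \<in> {a..b}; h < e\<rbrakk> \<Longrightarrow> g' s < g' (s + h)"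
      using has_real_derivative_pos_inc_right[OF g' \<open>0 < d\<close>] by blast
    define v where "v = min b (s + e / 2)"
    have v: "s < v" "v \<le> b" "v < s + e" using e True by (auto simp: v_def min_def)
    obtain z where z: "z \<in> {s<..<v}" "g v - g s = g' z * (v - s)"
      using mvt[of s v] v s by auto
    have "0 < g' z" using e(2)[of "z - s"] z v s crit by auto
    then have "g s < g v" using z v by (metis diff_gt_0_iff_gt mult_pos_pos)
    then show False using max[of v] v s by auto
  next
    case False
    then have "s = b" using s by auto
    obtain e where e: "e > 0" "\<And>h. \<lbrakk>h > 0; s - h \<in> {a..b}; h < e\<rbrakk> \<Longrightarrow> g' (s - h) < g' s"
      using has_real_derivative_pos_inc_left[OF g' \<open>0 < d\<close>] by blast
    define u where "u = max a (s - e / 2)"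
    have u: "a \<le> u" "u < s" "s - e < u"
      using e \<open>s = b\<close> \<open>a < b\<close> by (auto simp: u_def max_def)
    obtain z where z: "z \<in> {u<..<s}" "g s - g u = g' z * (s - u)"
      using mvt[of u s] u s by auto
    have "g' z < 0" using e(2)[of "s - z"] z u s crit by auto
    then have "g s < g u" using z u by (metis diff_gt_0_iff_gt diff_less_0_iff_less mult_neg_pos)
    then show False using max[of u] u s by auto
  qed
qed

lemma partial_along_coordinate_line:
  fixes u :: "real ^ 'n \<Rightarrow> real"
  assumes u: "u differentiable_on Omega" and x: "x \<in> Omega" and t: "t \<in> {-1..1}"
  shows "((\<lambda>t. u (x + (t - x $ i) *\<^sub>R axis i 1)) has_real_derivative
           partial i u (x + (t - x $ i) *\<^sub>R axis i 1)) (at t within {-1..1})"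
proof -
  define y where "y = (\<lambda>t. x + (t - x $ i) *\<^sub>R axis i (1::real))"
  have y_in: "y r \<in> Omega" if "r \<in> {-1..1}" for r
    using x that by (auto simp: y_def Omega_def mem_box_cart axis_def)
  have "(u has_derivative frechet_derivative u (at (y t) within Omega)) (at (y t) within Omega)"
    using u y_in[OF t] unfolding differentiable_on_def frechet_derivative_works by blast
  then have D: "(u has_derivative frechet_derivative u (at (y t) within Omega))
      (at (y t) within y ` {-1..1})"
    by (rule has_derivative_subset) (use y_in in auto)
  have "(y has_derivative (\<lambda>h. h *\<^sub>R axis i 1)) (at t within {-1..1})"
    unfolding y_def by (auto intro!: derivative_eq_intros)
  from diff_chain_within[OF this D]
  have "(u \<circ> y has_derivative (\<lambda>h. frechet_derivative u (at (y t) within Omega) (h *\<^sub>R axis i 1)))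
      (at t within {-1..1})"
    by (simp add: o_def)
  moreover have "frechet_derivative u (at (y t) within Omega) (h *\<^sub>R axis i 1) = partial i u (y t) * h"
    for h
    using linear_scale[OF has_derivative_linear[OF D]] by (simp add: partial_def)
  ultimately show ?thesis
    by (simp add: has_field_derivative_def o_def y_def)
qed

text \<open>
  Stated for a pair of functions rather than for their difference, so that linearity of the
  derivatives taken within the cube is not needed.
\<close>

lemma laplacian_le_at_max:
  fixes u v :: "real ^ 'n \<Rightarrow> real"
  assumes u: "C_k_on_Omega 2 u" "neumann u" and v: "C_k_on_Omega 2 v" "neumann v"
    and x: "x \<in> Omega" and max: "\<And>y. y \<in> Omega \<Longrightarrow> u y - v y \<le> u x - v x"
  shows "laplacian u x \<le> laplacian v x"
  unfolding laplacian_def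
proof (rule sum_mono)
  fix i
  have diff: "u differentiable_on Omega" "v differentiable_on Omega"
    "partial i u differentiable_on Omega" "partial i v differentiable_on Omega"
    using u v by (auto simp: numeral_2_eq_2)
  define y where "y = (\<lambda>t. x + (t - x $ i) *\<^sub>R axis i (1::real))"
  have xi: "x $ i \<in> {-1..1}"
    using x by (auto simp: Omega_def mem_box_cart)
  have y_in: "y t \<in> Omega" if "t \<in> {-1..1}" for t
    using x that by (auto simp: y_def Omega_def mem_box_cart axis_def)
  have y_xi: "y (x $ i) = x" by (simp add: y_def)
  have deriv: "((\<lambda>t. f (y t)) has_real_derivative partial i f (y t)) (at t within {-1..1})"
    if "f differentiable_on Omega" "t \<in> {-1..1}" for f t
    using partial_along_coordinate_line[OF that(1) x that(2)] by (simp add: y_def)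
  have "partial i (partial i u) x - partial i (partial i v) x \<le> 0"
  proof (rule second_derivative_nonpos_at_max[of "-1" 1 "x $ i"])
    show "((\<lambda>t. u (y t) - v (y t)) has_real_derivative partial i u (y t) - partial i v (y t))
        (at t within {-1..1})" if "t \<in> {-1..1}" for t
      using deriv[OF diff(1) that] deriv[OF diff(2) that] by (rule DERIV_diff)
    show "((\<lambda>t. partial i u (y t) - partial i v (y t)) has_real_derivative
        partial i (partial i u) x - partial i (partial i v) x) (at (x $ i) within {-1..1})"
      using deriv[OF diff(3) xi] deriv[OF diff(4) xi] by (auto simp: y_xi intro: DERIV_diff)
    show "u (y t) - v (y t) \<le> u (y (x $ i)) - v (y (x $ i))" if "t \<in> {-1..1}" for t
      using max[OF y_in[OF that]] by (simp add: y_xi)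
    show "partial i u (y (x $ i)) - partial i v (y (x $ i)) = 0" if "x $ i = - 1 \<or> x $ i = 1"
      using u(2) v(2) x that by (auto simp: neumann_def y_xi)
  qed (use xi in auto)
  then show "partial i (partial i u) x \<le> partial i (partial i v) x" by simp
qed

text \<open>
  The comparison is between two solutions for the same old level \<open>\<phi>\<close>, which drops out of the
  difference of the two equations.
\<close>

lemma crank_nicolson_le:
  fixes \<phi> \<psi>\<^sub>1 \<psi>\<^sub>2 :: "real ^ 'n \<Rightarrow> real"
  assumes "\<epsilon> > 0" and "\<tau> > 0" and \<tau>: "\<tau> \<le> 2 * \<epsilon>\<^sup>2"
    and \<psi>\<^sub>1: "C_k_on_Omega 2 \<psi>\<^sub>1" "neumann \<psi>\<^sub>1" "crank_nicolson \<epsilon> \<tau> \<phi> \<psi>\<^sub>1"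
    and \<psi>\<^sub>2: "C_k_on_Omega 2 \<psi>\<^sub>2" "neumann \<psi>\<^sub>2" "crank_nicolson \<epsilon> \<tau> \<phi> \<psi>\<^sub>2"
    and z: "z \<in> Omega"
  shows "\<psi>\<^sub>1 z \<le> \<psi>\<^sub>2 z"
proof -
  have "continuous_on Omega (\<lambda>y. \<psi>\<^sub>1 y - \<psi>\<^sub>2 y)"
    using \<psi>\<^sub>1(1) \<psi>\<^sub>2(1)
    by (auto simp: numeral_2_eq_2 intro!: continuous_on_diff differentiable_imp_continuous_on)
  moreover have "compact (Omega :: (real ^ 'n) set)" by (simp add: Omega_def)
  ultimately obtain x where x: "x \<in> Omega"
      and max: "\<And>y. y \<in> Omega \<Longrightarrow> \<psi>\<^sub>1 y - \<psi>\<^sub>2 y \<le> \<psi>\<^sub>1 x - \<psi>\<^sub>2 x"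
    using continuous_attains_sup[of Omega "\<lambda>y. \<psi>\<^sub>1 y - \<psi>\<^sub>2 y"] z by blast
  define p where "p = \<psi>\<^sub>1 x"
  define q where "q = \<psi>\<^sub>2 x"
  have "p \<le> q"
  proof (rule ccontr)
    assume "\<not> p \<le> q"
    then have "0 < p - q" by simp
    have lap: "laplacian \<psi>\<^sub>1 x \<le> laplacian \<psi>\<^sub>2 x"
      using \<psi>\<^sub>1 \<psi>\<^sub>2 x max by (intro laplacian_le_at_max) auto
    have "(p - \<phi> x) / \<tau> - 1 / 2 * (laplacian \<psi>\<^sub>1 x + laplacian \<phi> x)
          + 1 / (2 * \<epsilon>\<^sup>2) * (p ^ 3 - p)
        = (q - \<phi> x) / \<tau> - 1 / 2 * (laplacian \<psi>\<^sub>2 x + laplacian \<phi> x)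
          + 1 / (2 * \<epsilon>\<^sup>2) * (q ^ 3 - q)"
      using \<psi>\<^sub>1(3) \<psi>\<^sub>2(3) x unfolding crank_nicolson_def p_def q_def by force
    then have "(p - q) / \<tau> + 1 / (2 * \<epsilon>\<^sup>2) * ((p ^ 3 - p) - (q ^ 3 - q))
        = 1 / 2 * (laplacian \<psi>\<^sub>1 x - laplacian \<psi>\<^sub>2 x)"
      by (simp add: add_divide_distrib diff_divide_distrib right_diff_distrib)
    also have "\<dots> \<le> 0" using lap by simp
    finally have nonpos: "(p - q) / \<tau> + 1 / (2 * \<epsilon>\<^sup>2) * ((p ^ 3 - p) - (q ^ 3 - q)) \<le> 0" .
    have factor: "(p - q) * a + b * ((p ^ 3 - p) - (q ^ 3 - q))
        = (p - q) * ((a - b) + b * (p\<^sup>2 + p * q + q\<^sup>2))" for a b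
      by algebra
    have "(p - q) / \<tau> + 1 / (2 * \<epsilon>\<^sup>2) * ((p ^ 3 - p) - (q ^ 3 - q))
        = (p - q) * ((1 / \<tau> - 1 / (2 * \<epsilon>\<^sup>2)) + 1 / (2 * \<epsilon>\<^sup>2) * (p\<^sup>2 + p * q + q\<^sup>2))"
      using factor[of "1 / \<tau>" "1 / (2 * \<epsilon>\<^sup>2)"] by simp
    moreover have "0 \<le> 1 / \<tau> - 1 / (2 * \<epsilon>\<^sup>2)"
      using \<tau> \<open>\<tau> > 0\<close> by (simp add: frac_le)
    moreover have "0 < 1 / (2 * \<epsilon>\<^sup>2) * (p\<^sup>2 + p * q + q\<^sup>2)"
    proof (rule mult_pos_pos)
      show "0 < 1 / (2 * \<epsilon>\<^sup>2)" using \<open>\<epsilon> > 0\<close> by simp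
      have "p\<^sup>2 + p * q + q\<^sup>2 = (p - q)\<^sup>2 / 4 + 3 * (p + q)\<^sup>2 / 4"
        by (simp add: power2_sum power2_diff add_divide_distrib diff_divide_distrib)
      also have "0 < \<dots>"
        using \<open>0 < p - q\<close> by (intro add_pos_nonneg) auto
      finally show "0 < p\<^sup>2 + p * q + q\<^sup>2" .
    qed
    ultimately show False
      using nonpos \<open>0 < p - q\<close> by (metis add_nonneg_pos mult_pos_pos not_less)
  qed
  then show ?thesis using max[OF z] by (simp add: p_def q_def)
qed

theorem mainTheorem2:
  fixes \<epsilon> \<tau> :: real
  assumes "\<epsilon> > 0" and "\<tau> > 0" and "\<tau> \<le> 2 * \<epsilon>\<^sup>2"
  shows "stable_scheme
    (crank_nicolson \<epsilon> \<tau> :: (real ^ 'n::finite \<Rightarrow> real) \<Rightarrow> (real ^ 'n \<Rightarrow> real) \<Rightarrow> bool)"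
  unfolding stable_scheme_def smooth_on_Omega_def
proof (intro allI impI ballI antisym; elim conjE)
  fix \<phi> \<psi>\<^sub>1 \<psi>\<^sub>2 :: "real ^ 'n \<Rightarrow> real" and x :: "real ^ 'n"
  assume \<psi>\<^sub>1: "\<forall>k. C_k_on_Omega k \<psi>\<^sub>1" "neumann \<psi>\<^sub>1" "crank_nicolson \<epsilon> \<tau> \<phi> \<psi>\<^sub>1"
    and \<psi>\<^sub>2: "\<forall>k. C_k_on_Omega k \<psi>\<^sub>2" "neumann \<psi>\<^sub>2" "crank_nicolson \<epsilon> \<tau> \<phi> \<psi>\<^sub>2"
    and x: "x \<in> Omega"
  note \<psi>\<^sub>1_sol = spec[OF \<psi>\<^sub>1(1)] \<psi>\<^sub>1(2,3) and \<psi>\<^sub>2_sol = spec[OF \<psi>\<^sub>2(1)] \<psi>\<^sub>2(2,3)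
  show "\<psi>\<^sub>1 x \<le> \<psi>\<^sub>2 x" by (rule crank_nicolson_le[OF assms \<psi>\<^sub>1_sol \<psi>\<^sub>2_sol x])
  show "\<psi>\<^sub>2 x \<le> \<psi>\<^sub>1 x" by (rule crank_nicolson_le[OF assms \<psi>\<^sub>2_sol \<psi>\<^sub>1_sol x])
qed

end
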